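(* Suppose that for each $s_0\in\mathcal S$, $y_0^*=y_0^*(s_0)$ attains the maximum in $\max_{y_0\in\mathbb R}\hat J_0^*(s_0,y_0)$, and that $\tilde u^*=(\tilde u_t^*;t\in\mathcal T)\in\tilde{\mathcal U}^{\rm MD}$ is a Markov deterministic optimal policy for the augmented MDP $\widetilde{\mathcal M}$. Then the history-dependent deterministic policy $u^*=(u_t^*;t\in\mathcal T)\in\mathcal U^{\rm HD}$ with $$u_t^*(s_0,a_0,\ldots,s_t):=\tilde u_t^*\Big(s_t,\;y_0^*-\sum_{\tau=0}^{t-1}r_\tau(s_\tau,a_\tau)\Big)$$ is optimal for the finite-horizon mean-variance MDP, i.e. $J_0^{u^*}(s_0)=J_0^*(s_0)$ for all $s_0\in\mathcal S$.
   Context: Original MDP. $\mathcal T=\{0,1,\ldots,T-1\}$ with $T<\infty$; $\mathcal S,\mathcal A$ are finite state and action spaces; $\mathcal A(s)\subset\mathcal A$ is the (nonempty) set of admissible actions at $s$, with $\cup_s\mathcal A(s)=\mathcal A$; $\mathcal K=\{(s,a):s\in\mathcal S,a\in\mathcal A(s)\}$; $P_t(\cdot|s,a)$ is a transition probability on $\mathcal S$ for each $(s,a)\in\mathcal K$, $t\in\mathcal T$; $r_t:\mathcal K\to\mathbb R$ is the reward function. A history-dependent randomized policy $u=(u_t)\in\mathcal U^{\rm HR}$ consists of probability distributions $u_t(\cdot|h_t)$ on $\mathcal A(s_t)$ given $h_t=(s_0,a_0,\ldots,s_{t-1},a_{t-1},s_t)$; $\mathcal U^{\rm HD}$ is the subset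 of history-dependent deterministic policies. $R_{0:T}=\sum_{\tau=0}^{T-1}r_\tau(s_\tau,a_\tau)$, $\mu_0^u(s_0)=\mathbb E^u_{s_0}[R_{0:T}]$, $\sigma_0^u(s_0)=\mathbb E^u_{s_0}[(R_{0:T}-\mu_0^u(s_0))^2]$. With a fixed $\lambda\ge0$, the mean-variance value and the mean-variance MDP are $$J_0^u(s_0)=\mu_0^u(s_0)-\lambda\sigma_0^u(s_0),\qquad J_0^*(s_0)=\sup_{u\in\mathcal U^{\rm HR}}J_0^u(s_0).$$ For $y_0\in\mathbb R$, $\hat J_0^u(s_0,y_0)=\mathbb E^u_{s_0}[R_{0:T}-\lambda(R_{0:T}-y_0)^2]$ and $\hat J_0^*(s_0,y_0)=\sup_{u\in\mathcal U^{\rm HR}}\hat J_0^u(s_0,y_0)$. Augmented MDP $\widetilde{\mathcal M}$. State space $\mathcal S\times\mathbb R$; admissible actions at $(s,y)$ are $\mathcal A(s)$; taking $a_t$ in $(s_t,y_t)$ at time $t$ gives reward $r_t(s_t,a_t)$ and next state $(s_{t+1},y_{t+1})$ with $s_{t+1}\sim P_t(\cdot|s_t,a_t)$, $y_{t+1}=y_t-r_t(s_t,a_t)$; the terminal reward is $-\lambda y_T^2$. $\tilde{\mathcal U}^{\rm HR}$ and $\tilde{\mathcal U}^{\rm MD}$ are its sets of history-dependent randomized and Markov deterministic policies (the latter with decisions $\tilde u_t(s_t,y_t)\in\mathcal A(s_t)$). $V_0^{\tilde u}(s_0,y_0)=\mathbb E^{\tilde u}_{(s_0,y_0)}[\sum_{t=0}^{T-1}r_t(s_t,a_t)-\lambda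 y_T^2]$; a policy $\tilde u^*$ is optimal for $\widetilde{\mathcal M}$ if $V_0^{\tilde u^*}(s_0,y_0)=\sup_{\tilde u\in\tilde{\mathcal U}^{\rm HR}}V_0^{\tilde u}(s_0,y_0)$ for all $(s_0,y_0)\in\mathcal S\times\mathbb R$. *)

theory Defs
  imports "HOL-Probability.Probability_Mass_Function"
begin

text \<open>
  Finite-horizon, time-inhomogeneous Markov decision processes with decision epochs
  \<open>0, \<dots>, horizon M - 1\<close>.  State and action spaces are types.  \<open>trans\<close> and \<open>reward\<close>
  are total functions, but policies only ever select admissible actions, so their values at
  inadmissible pairs are irrelevant.
\<close>

record ('s, 'a) mdp =
  horizon :: nat
  acts :: "'s \<Rightarrow> 'a set"
  trans :: "nat \<Rightarrow> 's \<Rightarrow> 'a \<Rightarrow> 's pmf"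
  reward :: "nat \<Rightarrow> 's \<Rightarrow> 'a \<Rightarrow> real"

definition valid_mdp :: "('s, 'a) mdp \<Rightarrow> bool" where
  "valid_mdp M \<longleftrightarrow> (\<forall>s. acts M s \<noteq> {}) \<and> (\<Union>s. acts M s) = UNIV"

definition admissible_pairs :: "('s, 'a) mdp \<Rightarrow> ('s \<times> 'a) set" where
  "admissible_pairs M = {(s, a). a \<in> acts M s}"

text \<open>
  The history \<open>h\<^sub>t = (s\<^sub>0, a\<^sub>0, \<dots>, s\<^sub>t\<^sub>-\<^sub>1, a\<^sub>t\<^sub>-\<^sub>1, s\<^sub>t)\<close> is represented by
  \<open>([(s\<^sub>0, a\<^sub>0), \<dots>, (s\<^sub>t\<^sub>-\<^sub>1, a\<^sub>t\<^sub>-\<^sub>1)], s\<^sub>t)\<close>.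
\<close>

type_synonym ('s, 'a) history = "('s \<times> 'a) list \<times> 's"

type_synonym ('s, 'a) policy = "nat \<Rightarrow> ('s, 'a) history \<Rightarrow> 'a pmf"

definition histories :: "('s, 'a) mdp \<Rightarrow> nat \<Rightarrow> ('s, 'a) history set" where
  "histories M t = {(xs, s). length xs = t \<and> set xs \<subseteq> admissible_pairs M}"

definition current_state :: "('s, 'a) history \<Rightarrow> 's" where
  "current_state h = snd h"

definition initial_state :: "('s, 'a) history \<Rightarrow> 's" where
  "initial_state h = (case fst h of [] \<Rightarrow> snd h | (s\<^sub>0, a\<^sub>0) # _ \<Rightarrow> s\<^sub>0)"

definition cumulative_reward :: "('s, 'a) mdp \<Rightarrow> ('s, 'a) history \<Rightarrow> real" where
  "cumulative_reward M h =
     (\<Sum>\<tau><length (fst h). reward M \<tau> (fst (fst h ! \<tau>)) (snd (fst h ! \<tau>)))"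

definition policies_HR :: "('s, 'a) mdp \<Rightarrow> ('s, 'a) policy set" where
  "policies_HR M =
     {u. \<forall>t<horizon M. \<forall>h\<in>histories M t. set_pmf (u t h) \<subseteq> acts M (current_state h)}"

definition policies_HD :: "('s, 'a) mdp \<Rightarrow> ('s, 'a) policy set" where
  "policies_HD M =
     {u \<in> policies_HR M. \<forall>t<horizon M. \<forall>h\<in>histories M t. \<exists>a. u t h = return_pmf a}"

definition policies_MD :: "('s, 'a) mdp \<Rightarrow> (nat \<Rightarrow> 's \<Rightarrow> 'a) set" where
  "policies_MD M = {d. \<forall>t<horizon M. \<forall>s. d t s \<in> acts M s}"

definition policy_of_MD :: "(nat \<Rightarrow> 's \<Rightarrow> 'a) \<Rightarrow> ('s, 'a) policy" where
  "policy_of_MD d t h = return_pmf (d t (current_state h))"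

text \<open>The law of \<open>h\<^sub>t\<close> when starting in \<open>s\<^sub>0\<close> and following \<open>u\<close>.\<close>

primrec history_pmf ::
    "('s, 'a) mdp \<Rightarrow> ('s, 'a) policy \<Rightarrow> 's \<Rightarrow> nat \<Rightarrow> ('s, 'a) history pmf" where
  "history_pmf M u s\<^sub>0 0 = return_pmf ([], s\<^sub>0)"
| "history_pmf M u s\<^sub>0 (Suc t) =
     bind_pmf (history_pmf M u s\<^sub>0 t) (\<lambda>(xs, s).
       bind_pmf (u t (xs, s)) (\<lambda>a.
         map_pmf (\<lambda>s'. (xs @ [(s, a)], s')) (trans M t s a)))"

definition expect ::
    "('s, 'a) mdp \<Rightarrow> ('s, 'a) policy \<Rightarrow> 's \<Rightarrow> (('s, 'a) history \<Rightarrow> real) \<Rightarrow> real" where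
  "expect M u s\<^sub>0 f = measure_pmf.expectation (history_pmf M u s\<^sub>0 (horizon M)) f"


text \<open>
  Histories under \<open>expect\<close> have length \<open>horizon M\<close>, so \<open>cumulative_reward M\<close> is
  \<open>R\<^sub>0\<^sub>:\<^sub>T\<close> there.  All suprema below are over bounded nonempty sets of reals when the state
  and action types of the original model are finite and \<open>valid_mdp M\<close> holds.
\<close>

definition mean :: "('s, 'a) mdp \<Rightarrow> ('s, 'a) policy \<Rightarrow> 's \<Rightarrow> real" where
  "mean M u s\<^sub>0 = expect M u s\<^sub>0 (cumulative_reward M)"

definition variance :: "('s, 'a) mdp \<Rightarrow> ('s, 'a) policy \<Rightarrow> 's \<Rightarrow> real" where
  "variance M u s\<^sub>0 = expect M u s\<^sub>0 (\<lambda>h. (cumulative_reward M h - mean M u s\<^sub>0)\<^sup>2)"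

definition J :: "('s, 'a) mdp \<Rightarrow> real \<Rightarrow> ('s, 'a) policy \<Rightarrow> 's \<Rightarrow> real" where
  "J M lam u s\<^sub>0 = mean M u s\<^sub>0 - lam * variance M u s\<^sub>0"

definition J_star :: "('s, 'a) mdp \<Rightarrow> real \<Rightarrow> 's \<Rightarrow> real" where
  "J_star M lam s\<^sub>0 = (SUP u\<in>policies_HR M. J M lam u s\<^sub>0)"

definition J_hat :: "('s, 'a) mdp \<Rightarrow> real \<Rightarrow> ('s, 'a) policy \<Rightarrow> 's \<Rightarrow> real \<Rightarrow> real" where
  "J_hat M lam u s\<^sub>0 y\<^sub>0 =
     expect M u s\<^sub>0 (\<lambda>h. cumulative_reward M h - lam * (cumulative_reward M h - y\<^sub>0)\<^sup>2)"

definition J_hat_star :: "('s, 'a) mdp \<Rightarrow> real \<Rightarrow> 's \<Rightarrow> real \<Rightarrow> real" where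
  "J_hat_star M lam s\<^sub>0 y\<^sub>0 = (SUP u\<in>policies_HR M. J_hat M lam u s\<^sub>0 y\<^sub>0)"


text \<open>
  No measurability in the real component is imposed on policies of the augmented model: from a
  given initial state only finitely many histories are reachable, so the discrete
  \<open>history_pmf\<close> makes sense for arbitrary policies.
\<close>

definition augmented :: "('s, 'a) mdp \<Rightarrow> ('s \<times> real, 'a) mdp" where
  "augmented M =
     \<lparr> horizon = horizon M,
       acts = (\<lambda>(s, y). acts M s),
       trans = (\<lambda>t (s, y) a. map_pmf (\<lambda>s'. (s', y - reward M t s a)) (trans M t s a)),
       reward = (\<lambda>t (s, y) a. reward M t s a) \<rparr>"

definition V :: "('s, 'a) mdp \<Rightarrow> real \<Rightarrow> ('s \<times> real, 'a) policy \<Rightarrow> 's \<times> real \<Rightarrow> real" where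
  "V M lam u x\<^sub>0 =
     expect (augmented M) u x\<^sub>0
       (\<lambda>h. cumulative_reward (augmented M) h - lam * (snd (current_state h))\<^sup>2)"

definition augmented_optimal ::
    "('s, 'a) mdp \<Rightarrow> real \<Rightarrow> ('s \<times> real, 'a) policy \<Rightarrow> bool" where
  "augmented_optimal M lam u \<longleftrightarrow>
     (\<forall>s\<^sub>0 y\<^sub>0. V M lam u (s\<^sub>0, y\<^sub>0) = (SUP v\<in>policies_HR (augmented M). V M lam v (s\<^sub>0, y\<^sub>0)))"

definition induced_policy ::
    "('s, 'a) mdp \<Rightarrow> ('s \<Rightarrow> real) \<Rightarrow> (nat \<Rightarrow> 's \<times> real \<Rightarrow> 'a) \<Rightarrow> ('s, 'a) policy" where
  "induced_policy M y d t h =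
     return_pmf (d t (current_state h, y (initial_state h) - cumulative_reward M h))"

end

(*
  Since E[(R - y)^2] = Var R + (E R - y)^2, the value J is the maximum of J_hat over y, attained at
  the mean.  Conversely, J_hat with fixed y is the value of the augmented MDP started in (s0, y):
  the auxiliary coordinate is a function of the original history, so every history of the original
  model has a unique augmented counterpart and policies can be moved back and forth along this
  correspondence without changing the law.  Hence u_tilde yields a maximiser of J_hat(., y_star),
  and maximising over y first or over u first gives the same value.
*)
theory Submission
  imports Defs
begin

lemma history_pmf_support:
  assumes "h \<in> set_pmf (history_pmf M u s\<^sub>0 t)"
  shows "length (fst h) = t" "initial_state h = s\<^sub>0"
proof -
  have "length (fst h) = t \<and> initial_state h = s\<^sub>0"
    using assms
  proof (induction t arbitrary: h)
    case 0
    then show ?case by (simp add: initial_state_def)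
  next
    case (Suc t)
    then obtain xs s a s' where "(xs, s) \<in> set_pmf (history_pmf M u s\<^sub>0 t)"
      and "h = (xs @ [(s, a)], s')"
      by auto
    with Suc.IH[of "(xs, s)"] show ?case
      by (cases xs) (auto simp: initial_state_def)
  qed
  then show "length (fst h) = t" "initial_state h = s\<^sub>0" by auto
qed

text \<open>Needed because \<open>induced_policy\<close> evaluates \<open>y\<close> at the initial
  state of the history: it agrees with the policy for a fixed target only on histories starting at
  \<open>s\<^sub>0\<close>, and these carry all the mass.\<close>

lemma history_pmf_cong:
  assumes "\<And>t h. length (fst h) = t \<Longrightarrow> initial_state h = s\<^sub>0 \<Longrightarrow> u t h = v t h"
  shows "history_pmf M u s\<^sub>0 t = history_pmf M v s\<^sub>0 t"
proof (induction t)
  case (Suc t)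
  show ?case
    unfolding history_pmf.simps Suc.IH
  proof (rule bind_pmf_cong[OF refl])
    fix h assume "h \<in> set_pmf (history_pmf M v s\<^sub>0 t)"
    then have "u t h = v t h"
      by (intro assms history_pmf_support)
    then show "(case h of (xs, s) \<Rightarrow> bind_pmf (u t (xs, s))
          (\<lambda>a. map_pmf (Pair (xs @ [(s, a)])) (trans M t s a))) =
        (case h of (xs, s) \<Rightarrow> bind_pmf (v t (xs, s))
          (\<lambda>a. map_pmf (Pair (xs @ [(s, a)])) (trans M t s a)))"
      by (cases h) simp
  qed
qed simp

lemma finite_histories_length:
  "finite {h :: ('s::finite, 'a::finite) history. length (fst h) = n}"
proof -
  have "{h :: ('s, 'a) history. length (fst h) = n} = {xs. length xs = n} \<times> UNIV"
    by auto
  moreover have "finite {xs :: ('s \<times> 'a) list. length xs = n}"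
    using finite_lists_length_eq[of "UNIV :: ('s \<times> 'a) set" n] by simp
  ultimately show ?thesis by simp
qed

lemma integrable_history_pmf:
  fixes M :: "('s::finite, 'a::finite) mdp" and f :: "('s, 'a) history \<Rightarrow> real"
  shows "integrable (measure_pmf (history_pmf M u s\<^sub>0 t)) f"
proof (rule integrable_measure_pmf_finite)
  have "set_pmf (history_pmf M u s\<^sub>0 t) \<subseteq> {h. length (fst h) = t}"
    by (auto dest: history_pmf_support(1))
  then show "finite (set_pmf (history_pmf M u s\<^sub>0 t))"
    by (rule finite_subset) (rule finite_histories_length)
qed

lemma J_hat_eq:
  fixes M :: "('s::finite, 'a::finite) mdp"
  shows "J_hat M lam u s\<^sub>0 y = J M lam u s\<^sub>0 - lam * (mean M u s\<^sub>0 - y)\<^sup>2"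
proof -
  let ?m = "mean M u s\<^sub>0"
  let ?E = "measure_pmf.expectation (history_pmf M u s\<^sub>0 (horizon M))"
  let ?R = "cumulative_reward M"
  note [simp] = integrable_history_pmf
  have "J_hat M lam u s\<^sub>0 y = ?E (\<lambda>h. ?R h - lam * (?R h - y)\<^sup>2)"
    by (simp add: J_hat_def expect_def)
  \<comment> \<open>Expand the square around the mean. The cross term is linear in the deviation
    from \<open>?m\<close>, so it vanishes once \<open>?E ?R\<close> is replaced by
    \<open>?m\<close>.\<close>
  also have "\<dots> = ?E (\<lambda>h. ?R h - lam * (?R h - ?m)\<^sup>2
      - lam * (2 * (?m - y)) * (?R h - ?m) - lam * (?m - y)\<^sup>2)"
    by (intro arg_cong[where f = ?E] ext) (simp add: power2_eq_square algebra_simps)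
  also have "\<dots> = ?E ?R - lam * ?E (\<lambda>h. (?R h - ?m)\<^sup>2)
      - lam * (2 * (?m - y)) * (?E ?R - ?m) - lam * (?m - y)\<^sup>2"
    by simp
  also have "?E ?R = ?m"
    by (simp add: mean_def expect_def)
  finally show ?thesis
    by (simp add: J_def variance_def expect_def)
qed

text \<open>The bound is a maximum over all full-length histories, finitely many and chosen without
  reference to \<open>u\<close>. This uniformity makes the suprema over policies bounded above, as
  \<open>cSUP_upper\<close> requires.\<close>

lemma bounded_J_hat:
  fixes M :: "('s::finite, 'a::finite) mdp"
  shows "\<exists>C. \<forall>u. J_hat M lam u s\<^sub>0 y \<le> C"
proof -
  let ?f = "\<lambda>h. cumulative_reward M h - lam * (cumulative_reward M h - y)\<^sup>2"
  let ?A = "{h :: ('s, 'a) history. length (fst h) = horizon M}"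
  have "J_hat M lam u s\<^sub>0 y \<le> Max (?f ` ?A)" for u
    unfolding J_hat_def expect_def
  proof (rule measure_pmf.integral_le_const)
    show "AE h in measure_pmf (history_pmf M u s\<^sub>0 (horizon M)). ?f h \<le> Max (?f ` ?A)"
      by (auto simp: AE_measure_pmf_iff finite_histories_length dest: history_pmf_support(1)
          intro!: Max_ge)
  qed (rule integrable_history_pmf)
  then show ?thesis by blast
qed

text \<open>The pair \<open>(take i (fst h), snd h)\<close> stands for the history up to epoch
  \<open>i\<close>; its last state is a dummy, since \<open>cumulative_reward\<close> reads only the
  list.\<close>

definition augment_history ::
    "('s, 'a) mdp \<Rightarrow> real \<Rightarrow> ('s, 'a) history \<Rightarrow> ('s \<times> real, 'a) history" where
  "augment_history M y h =
     (map (\<lambda>i. ((fst (fst h ! i), y - cumulative_reward M (take i (fst h), snd h)),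
        snd (fst h ! i))) [0..<length (fst h)],
      (snd h, y - cumulative_reward M h))"

definition strip_history :: "('s \<times> real, 'a) history \<Rightarrow> ('s, 'a) history" where
  "strip_history h = (map (\<lambda>p. (fst (fst p), snd p)) (fst h), fst (snd h))"

text \<open>The final state of a history earns nothing, so \<open>s'\<close> and \<open>s''\<close>
  may be unrelated.\<close>

lemma cumulative_reward_snoc:
  "cumulative_reward M (xs @ [(s, a)], s') =
     cumulative_reward M (xs, s'') + reward M (length xs) s a"
  by (auto simp: cumulative_reward_def nth_append intro!: sum.cong)

lemma augment_history_snoc:
  "augment_history M y (xs @ [(s, a)], s') =
     (fst (augment_history M y (xs, s)) @ [((s, y - cumulative_reward M (xs, s)), a)],
      (s', y - cumulative_reward M (xs, s) - reward M (length xs) s a))"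
  by (simp add: augment_history_def cumulative_reward_snoc[where s'' = s] nth_append
      cumulative_reward_def)

lemma strip_augment_history: "strip_history (augment_history M y h) = h"
  by (cases h) (auto simp: strip_history_def augment_history_def intro!: nth_equalityI)

lemma cumulative_reward_augment:
  "cumulative_reward (augmented M) (augment_history M y h) = cumulative_reward M h"
  by (auto simp: cumulative_reward_def augment_history_def augmented_def intro!: sum.cong)

text \<open>The only randomness in an augmented transition is that of the original state. The
  augmented law is therefore a pushforward, under the original policy that rebuilds the augmented
  history and consults \<open>w\<close>.\<close>

lemma history_pmf_augmented:
  "history_pmf (augmented M) w (s\<^sub>0, y) t =
     map_pmf (augment_history M y) (history_pmf M (\<lambda>t h. w t (augment_history M y h)) s\<^sub>0 t)"
proof (induction t)
  case 0
  show ?case by (simp add: augment_history_def cumulative_reward_def)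
next
  case (Suc t)
  let ?u = "\<lambda>t h. w t (augment_history M y h)"
  show ?case
    unfolding history_pmf.simps Suc.IH bind_map_pmf map_bind_pmf
  proof (rule bind_pmf_cong[OF refl])
    \<comment> \<open>\<open>augment_history_snoc\<close> charges the reward of epoch
      \<open>length xs\<close>, the transition that of epoch \<open>t\<close>; on the support the
      two coincide.\<close>
    fix h assume "h \<in> set_pmf (history_pmf M ?u s\<^sub>0 t)"
    then have len: "length (fst h) = t"
      by (rule history_pmf_support)
    obtain xs s where h: "h = (xs, s)" by (cases h)
    obtain zs where zs: "augment_history M y (xs, s) = (zs, (s, y - cumulative_reward M (xs, s)))"
      by (simp add: augment_history_def)
    show "(case augment_history M y h of (xs, s) \<Rightarrow> bind_pmf (w t (xs, s))
          (\<lambda>a. map_pmf (Pair (xs @ [(s, a)])) (trans (augmented M) t s a))) =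
        map_pmf (augment_history M y) (case h of (xs, s) \<Rightarrow> bind_pmf (?u t (xs, s))
          (\<lambda>a. map_pmf (Pair (xs @ [(s, a)])) (trans M t s a)))"
      using len unfolding h
      by (simp add: zs map_bind_pmf pmf.map_comp o_def augment_history_snoc augmented_def)
  qed
qed

lemma V_eq_J_hat:
  "V M lam w (s\<^sub>0, y) = J_hat M lam (\<lambda>t h. w t (augment_history M y h)) s\<^sub>0 y"
proof -
  have "snd (current_state (augment_history M y h)) = y - cumulative_reward M h" for h
    by (simp add: augment_history_def current_state_def)
  then show ?thesis
    by (simp add: V_def J_hat_def expect_def history_pmf_augmented cumulative_reward_augment
        augmented_def[of M, THEN arg_cong[where f = horizon]] power2_commute)
qed

lemma J_hat_induced_policy:
  "J_hat M lam (induced_policy M y d) s\<^sub>0 (y s\<^sub>0) = V M lam (policy_of_MD d) (s\<^sub>0, y s\<^sub>0)"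
proof -
  have "history_pmf M (induced_policy M y d) s\<^sub>0 t =
      history_pmf M (\<lambda>t h. policy_of_MD d t (augment_history M (y s\<^sub>0) h)) s\<^sub>0 t" for t
    by (rule history_pmf_cong)
      (simp add: induced_policy_def policy_of_MD_def current_state_def augment_history_def)
  then show ?thesis
    by (simp add: V_eq_J_hat J_hat_def expect_def)
qed

text \<open>Admissibility must hold even at augmented histories whose real coordinates do not match
  the rewards collected. It does, because neither \<open>strip_history\<close> nor the admissible
  actions look at those coordinates.\<close>

lemma strip_policy_in_policies_HR:
  assumes "u \<in> policies_HR M"
  shows "(\<lambda>t h. u t (strip_history h)) \<in> policies_HR (augmented M)"
  unfolding policies_HR_def
proof (intro CollectI allI impI ballI)
  fix t h assume t: "t < horizon (augmented M)" and h: "h \<in> histories (augmented M) t"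
  have "strip_history h \<in> histories M t"
    using h by (fastforce simp: histories_def strip_history_def admissible_pairs_def augmented_def)
  with assms t have "set_pmf (u t (strip_history h)) \<subseteq> acts M (current_state (strip_history h))"
    by (simp add: policies_HR_def augmented_def)
  then show "set_pmf (u t (strip_history h)) \<subseteq> acts (augmented M) (current_state h)"
    by (simp add: current_state_def strip_history_def augmented_def case_prod_beta)
qed

lemma induced_policy_in_policies_HD:
  assumes "d \<in> policies_MD (augmented M)"
  shows "induced_policy M y d \<in> policies_HD M"
  using assms
  by (auto simp: policies_HD_def policies_HR_def policies_MD_def induced_policy_def augmented_def)

lemma J_hat_le_V_optimal:
  fixes M :: "('s::finite, 'a::finite) mdp"
  assumes "augmented_optimal M lam w" and "u \<in> policies_HR M"
  shows "J_hat M lam u s\<^sub>0 y \<le> V M lam w (s\<^sub>0, y)"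
proof -
  obtain C where C: "\<And>v. J_hat M lam v s\<^sub>0 y \<le> C"
    using bounded_J_hat[of M lam s\<^sub>0 y] by blast
  \<comment> \<open>Stripping undoes augmenting, so pulling the stripped policy back to the original
    model returns exactly \<open>u\<close>.\<close>
  have "J_hat M lam u s\<^sub>0 y = V M lam (\<lambda>t h. u t (strip_history h)) (s\<^sub>0, y)"
    by (simp add: V_eq_J_hat strip_augment_history)
  also have "\<dots> \<le> (SUP v\<in>policies_HR (augmented M). V M lam v (s\<^sub>0, y))"
  proof (rule cSUP_upper)
    show "bdd_above ((\<lambda>v. V M lam v (s\<^sub>0, y)) ` policies_HR (augmented M))"
      by (rule bdd_aboveI2[where M = C]) (simp add: V_eq_J_hat C)
  qed (rule strip_policy_in_policies_HR[OF assms(2)])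
  also have "\<dots> = V M lam w (s\<^sub>0, y)"
    using assms(1) by (simp add: augmented_optimal_def)
  finally show ?thesis .
qed

theorem theorem3:
  fixes M :: "('s::finite, 'a::finite) mdp"
    and lam :: real
    and y_star :: "'s \<Rightarrow> real"
    and u_tilde :: "nat \<Rightarrow> 's \<times> real \<Rightarrow> 'a"
  assumes "valid_mdp M"
    and "lam \<ge> 0"
    and "\<And>s\<^sub>0 y. J_hat_star M lam s\<^sub>0 y \<le> J_hat_star M lam s\<^sub>0 (y_star s\<^sub>0)"
    and "u_tilde \<in> policies_MD (augmented M)"
    and "augmented_optimal M lam (policy_of_MD u_tilde)"
  shows "induced_policy M y_star u_tilde \<in> policies_HD M \<and>
    (\<forall>s\<^sub>0. J M lam (induced_policy M y_star u_tilde) s\<^sub>0 = J_star M lam s\<^sub>0)"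
proof (intro conjI allI)
  let ?u = "induced_policy M y_star u_tilde"
  show HD: "?u \<in> policies_HD M"
    using assms(4) by (rule induced_policy_in_policies_HD)
  then have HR: "?u \<in> policies_HR M"
    by (simp add: policies_HD_def)
  fix s\<^sub>0
  have "J M lam u s\<^sub>0 \<le> J M lam ?u s\<^sub>0" if u: "u \<in> policies_HR M" for u
  proof -
    let ?m = "mean M u s\<^sub>0"
    obtain C where C: "\<And>v. J_hat M lam v s\<^sub>0 ?m \<le> C"
      using bounded_J_hat[of M lam s\<^sub>0 ?m] by blast
    \<comment> \<open>At the target \<open>?m\<close> the quadratic penalty in
      \<open>J_hat_eq\<close> is zero.\<close>
    have "J M lam u s\<^sub>0 = J_hat M lam u s\<^sub>0 ?m"
      by (simp add: J_hat_eq)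
    also have "\<dots> \<le> J_hat_star M lam s\<^sub>0 ?m"
      unfolding J_hat_star_def by (intro cSUP_upper u bdd_aboveI2[where M = C] C)
    also have "\<dots> \<le> J_hat_star M lam s\<^sub>0 (y_star s\<^sub>0)"
      by (rule assms(3))
    \<comment> \<open>Rewriting turns the right side into the optimal augmented value, which
      dominates every policy; \<open>HR\<close> makes the supremum one over a nonempty set.\<close>
    also have "\<dots> \<le> J_hat M lam ?u s\<^sub>0 (y_star s\<^sub>0)"
      unfolding J_hat_star_def J_hat_induced_policy
      using HR by (intro cSUP_least J_hat_le_V_optimal assms(5)) auto
    \<comment> \<open>\<open>y_star s\<^sub>0\<close> need not be known to equal the mean under
      \<open>?u\<close>: as \<open>lam\<close> is nonnegative, the penalty can simply be
      dropped.\<close>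
    also have "\<dots> \<le> J M lam ?u s\<^sub>0"
      using assms(2) by (simp add: J_hat_eq)
    finally show ?thesis .
  qed
  then show "J M lam ?u s\<^sub>0 = J_star M lam s\<^sub>0"
    unfolding J_star_def using HR by (intro cSup_eq_maximum[symmetric]) auto
qed

end
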